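(* Let $m>1$ and let $\{R^{(k)}\}_{k\ge1}$ be a sequence of return matrices such that, for some constant $r\in(0,1)$, $\bar r^{(k)}_{ij}+\underline r^{(k)}_{ij}\ge r$ for all $i\ne j$ and all $k$, and $\max_{i,j}(\bar r^{(k)}_{ij}+\underline r^{(k)}_{ij})=1$ for all $k$. Let the predictions be linear: $R'^{(k+1)}=\sum_{l=1}^{d_k}a_{k,l}R^{(k-l+1)}$ with $1\le d_k\le k$, $a_{k,l}\ge0$, $\sum_{l=1}^{d_k}a_{k,l}=1$. Fix an integer $l>1$ and partition the days into consecutive blocks $\Gamma_i=\{\frac{i(i-1)l}{2}+1,\dots,\frac{i(i+1)l}{2}\}$, $i=1,2,\dots$ (for horizon $N$, the last block is truncated at $N$). Let $\gamma(i)>0$ with $\gamma(i)\to0$ as $i\to\infty$, and suppose that on each block $\Gamma_i$ the portfolios are generated by the IITC algorithm (respectively, on every block by the EIITC algorithm) with parameter $\gamma(i)$, starting at the first day of the block from a portfolio matrix $\psi^{(i(i-1)l/2+1)}$ whose off-diagonal entries are all at least $\varepsilon$, where $\varepsilon>0$ is a constant independent of $i$. Then, in the long term, the exponential growth rate of funds with transaction costs is at least as good as that achieved by the single best currency pair: for every pair $(i,j)$ with $i\neq j$, $$\liminf_{N\to\infty}\Big(R_N(\{\psi^{(k)}\},\{R^{(k)}\})-R_N^*(e_{ij},\{R^{(k)}\})\Big)\ge0 .$$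
   Context: Return matrices. There are $m>1$ currencies. A return matrix $R^{(k)}$ records, for each ordered pair $(i,j)$ of distinct currencies, nonnegative returns $\bar r^{(k)}_{ij}$ and $\underline r^{(k)}_{ij}$ (buying/selling); only the sums $\rho^{(k)}_{ij}:=\bar r^{(k)}_{ij}+\underline r^{(k)}_{ij}$ enter below, and diagonal returns are $0$. For the prediction $R'^{(k+1)}$ the corresponding sums are $\rho'^{(k+1)}_{ij}$. Portfolios. A portfolio matrix is $\psi=(\psi_{ij})\in\mathbb{R}^{m\times m}$ with $\psi_{ii}=0$, $\psi_{ij}>0$ for $i\ne j$, $\sum_{i,j}\psi_{ij}=1$. For a matrix $\psi$ and a return matrix $R$ put $\psi\diamond R=\sum_{i,j=1}^m\psi_{ij}(\bar r_{ij}+\underline r_{ij})$. $e_{ij}$ is the $m\times m$ matrix with $(i,j)$ entry $1$ and all other entries $0$. Capital and transaction costs. $F_k>0$ is the capital at the end of day $k$, $T_k$ the transaction cost charged at day $k$, $F'_k=F_{k-1}-T_k$, $F_k=F'_k(\psi^{(k)}\diamond R^{(k)})$, with $\psi^{(k)}\diamond R^{(k)}>0$. The proportions automatically reached at the end of day $k$ are $\psi'^{(k)}_{ij}=\frac{F'_k}{F_k}\psi^{(k)}_{ij}\rho^{(k)}_{ij}=\psi^{(k)}_{ij}\rho^{(k)}_{ij}/(\psi^{(k)}\diamond R^{(k)})$. With a fixed constant $c\in(0,1)$, $T_{k+1}=c\sum_{i,j=1}^m\big|F'_{k+1}\psi^{(k+1)}_{ij}-F'_k\psi^{(k)}_{ij}\rho^{(k)}_{ij}\big|$.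 The cost ratios are $c_1=0$ and $c_{k}=T_{k}/F_{k-1}$ for $k\ge2$ (equivalently, $c_{k+1}=c\sum_{i,j}|(1-c_{k+1})\psi^{(k+1)}_{ij}-\psi'^{(k)}_{ij}|$); this includes the cost of rebalancing to the starting portfolio of a new block. Algorithms with parameter $\gamma>0$ (used to pass from day $k$ to day $k+1$ when both lie in the same block, with $\gamma=\gamma(i)$ on $\Gamma_i$): IITC: $\displaystyle \psi^{(k+1)}_{ij}=\frac{\psi'^{(k)}_{ij}\exp(\gamma\rho'^{(k+1)}_{ij})}{\sum_{u,v=1}^m\psi'^{(k)}_{uv}\exp(\gamma\rho'^{(k+1)}_{uv})}$; EIITC: $\displaystyle \psi^{(k+1)}_{ij}=\frac{\psi'^{(k)}_{ij}\exp\big(\gamma\rho'^{(k+1)}_{ij}/(\psi'^{(k)}\diamond R'^{(k+1)})\big)}{\sum_{u,v=1}^m\psi'^{(k)}_{uv}\exp\big(\gamma\rho'^{(k+1)}_{uv}/(\psi'^{(k)}\diamond R'^{(k+1)})\big)}$. Growth rates. With transaction costs: $R_N(\{\psi^{(k)}\},\{R^{(k)}\})=\frac1N\sum_{k=1}^N\log(\psi^{(k)}\diamond R^{(k)})+\frac1N\sum_{k=1}^N\log(1-c_k)$. For investing only in the pair $(i,j)$: $R^*_N(e_{ij},\{R^{(k)}\})=\frac1N\sum_{k=1}^N\log(e_{ij}\diamond R^{(k)})$. *)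

theory Defs
  imports "HOL-Analysis.Analysis"
begin

text \<open>
  The currencies are the elements of a finite type. A pair of matrices holds the buying and the
  selling returns, so that linear combinations of return matrices are those of the product
  vector space.
\<close>

type_synonym 'm retmat = "(real ^ 'm ^ 'm) \<times> (real ^ 'm ^ 'm)"

definition return_matrix :: "'m::finite retmat \<Rightarrow> bool" where
  "return_matrix R \<longleftrightarrow>
     (\<forall>i j. fst R $ i $ j \<ge> 0 \<and> snd R $ i $ j \<ge> 0) \<and>
     (\<forall>i. fst R $ i $ i = 0 \<and> snd R $ i $ i = 0)"

definition rho :: "'m::finite retmat \<Rightarrow> 'm \<Rightarrow> 'm \<Rightarrow> real" where
  "rho R i j = fst R $ i $ j + snd R $ i $ j"

definition portfolio :: "real ^ 'm ^ 'm::finite \<Rightarrow> bool" where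
  "portfolio \<psi> \<longleftrightarrow>
     (\<forall>i. \<psi> $ i $ i = 0) \<and> (\<forall>i j. i \<noteq> j \<longrightarrow> \<psi> $ i $ j > 0) \<and>
     (\<Sum>i\<in>UNIV. \<Sum>j\<in>UNIV. \<psi> $ i $ j) = 1"

definition diamond_prod :: "real ^ 'm ^ 'm::finite \<Rightarrow> 'm retmat \<Rightarrow> real" (infixl "\<diamondop>" 70) where
  "\<psi> \<diamondop> R = (\<Sum>i\<in>UNIV. \<Sum>j\<in>UNIV. \<psi> $ i $ j * rho R i j)"

definition unit_matrix :: "'m \<Rightarrow> 'm \<Rightarrow> real ^ 'm ^ 'm::finite" where
  "unit_matrix i j = (\<chi> u v. if u = i \<and> v = j then 1 else 0)"

definition end_of_day :: "real ^ 'm ^ 'm::finite \<Rightarrow> 'm retmat \<Rightarrow> real ^ 'm ^ 'm" where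
  "end_of_day \<psi> R = (\<chi> i j. \<psi> $ i $ j * rho R i j / (\<psi> \<diamondop> R))"

text \<open>
  In both algorithms \<open>\<psi>'\<close> is the end-of-day portfolio of day \<open>k\<close> and \<open>R'\<close> is the prediction for
  day \<open>k + 1\<close>.
\<close>

definition iitc :: "real \<Rightarrow> 'm retmat \<Rightarrow> real ^ 'm ^ 'm \<Rightarrow> real ^ 'm ^ 'm::finite" where
  "iitc \<gamma> R' \<psi>' =
     (\<chi> i j. \<psi>' $ i $ j * exp (\<gamma> * rho R' i j) /
        (\<Sum>u\<in>UNIV. \<Sum>v\<in>UNIV. \<psi>' $ u $ v * exp (\<gamma> * rho R' u v)))"

definition eiitc :: "real \<Rightarrow> 'm retmat \<Rightarrow> real ^ 'm ^ 'm \<Rightarrow> real ^ 'm ^ 'm::finite" where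
  "eiitc \<gamma> R' \<psi>' =
     (\<chi> i j. \<psi>' $ i $ j * exp (\<gamma> * rho R' i j / (\<psi>' \<diamondop> R')) /
        (\<Sum>u\<in>UNIV. \<Sum>v\<in>UNIV. \<psi>' $ u $ v * exp (\<gamma> * rho R' u v / (\<psi>' \<diamondop> R'))))"

text \<open>
  Days are numbered from 1; \<open>F 0\<close> is the initial capital. The cost \<open>T (k + 1)\<close> is given only
  implicitly, because \<open>F' (k + 1) = F k - T (k + 1)\<close> occurs in its own equation.
\<close>

definition capital_process ::
  "real \<Rightarrow> (nat \<Rightarrow> real) \<Rightarrow> (nat \<Rightarrow> real) \<Rightarrow> (nat \<Rightarrow> real) \<Rightarrow>
   (nat \<Rightarrow> real ^ 'm ^ 'm::finite) \<Rightarrow> (nat \<Rightarrow> 'm retmat) \<Rightarrow> bool" where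
  "capital_process c F F' T \<psi> R \<longleftrightarrow>
     (\<forall>k. F k > 0) \<and>
     T 1 = 0 \<and>
     (\<forall>k\<ge>1. F' k = F (k - 1) - T k) \<and>
     (\<forall>k\<ge>1. F k = F' k * (\<psi> k \<diamondop> R k)) \<and>
     (\<forall>k\<ge>1. T (k + 1) =
        c * (\<Sum>i\<in>UNIV. \<Sum>j\<in>UNIV.
               \<bar>F' (k + 1) * \<psi> (k + 1) $ i $ j - F' k * \<psi> k $ i $ j * rho (R k) i j\<bar>))"

definition cost_ratio :: "(nat \<Rightarrow> real) \<Rightarrow> (nat \<Rightarrow> real) \<Rightarrow> nat \<Rightarrow> real" where
  "cost_ratio F T k = (if k \<le> 1 then 0 else T k / F (k - 1))"

text \<open>The factor 2 divides \<open>i * (i - 1)\<close> and \<open>i * (i + 1)\<close>, so the divisions are exact.\<close>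

definition block :: "nat \<Rightarrow> nat \<Rightarrow> nat set" where
  "block l i = {i * (i - 1) * l div 2 + 1 .. i * (i + 1) * l div 2}"

definition growth_rate_tc ::
  "nat \<Rightarrow> (nat \<Rightarrow> real ^ 'm ^ 'm::finite) \<Rightarrow> (nat \<Rightarrow> 'm retmat) \<Rightarrow> (nat \<Rightarrow> real) \<Rightarrow> real" where
  "growth_rate_tc N \<psi> R cr =
     1 / real N * (\<Sum>k=1..N. ln (\<psi> k \<diamondop> R k)) + 1 / real N * (\<Sum>k=1..N. ln (1 - cr k))"

definition growth_rate_single ::
  "nat \<Rightarrow> real ^ 'm ^ 'm::finite \<Rightarrow> (nat \<Rightarrow> 'm retmat) \<Rightarrow> real" where
  "growth_rate_single N \<phi> R = 1 / real N * (\<Sum>k=1..N. ln (\<phi> \<diamondop> R k))"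

end

theory Submission
  imports Defs
begin

text \<open>
  Let \<open>p\<close> be the end-of-day portfolio of day \<open>k\<close>. Since \<open>ln (\<psi> k \<diamondop> R k) - ln (rho (R k) i j)\<close>
  equals \<open>ln (\<psi> k $ i $ j) - ln (p $ i $ j)\<close>, the excess log-growth over the pair \<open>(i, j)\<close>
  telescopes up to the rebalancing terms \<open>ln (\<psi> (k + 1) $ i $ j) - ln (p $ i $ j)\<close>. Inside a
  block one step of either algorithm changes every entry of \<open>p\<close> by a factor between
  \<open>exp (- \<gamma> / r)\<close> and \<open>exp (\<gamma> / r)\<close>, so that both this term and the cost of the step are small
  with \<open>\<gamma>\<close>. The start of a block costs at most a constant depending on \<open>\<epsilon>\<close> and \<open>c\<close>, and among the
  first \<open>N\<close> days only \<open>O(sqrt N)\<close> start a block. Hence the average loss tends to 0.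
\<close>

section \<open>Averages of sequences and the number of block starts\<close>

lemma cesaro_null:
  fixes x :: "nat \<Rightarrow> real"
  assumes "x \<longlonglongrightarrow> 0"
  shows "(\<lambda>N. (\<Sum>k=1..N. x k) / real N) \<longlonglongrightarrow> 0"
proof (rule LIMSEQ_I)
  fix e :: real assume e: "0 < e"
  obtain n0 where n0: "\<And>n. n \<ge> n0 \<Longrightarrow> \<bar>x n\<bar> < e / 2"
    using LIMSEQ_D[OF assms, of "e / 2"] e by auto
  define B where "B = (\<Sum>k=1..n0. \<bar>x k\<bar>)"
  have B: "B \<ge> 0" unfolding B_def by (intro sum_nonneg) auto
  \<comment> \<open>Beyond \<open>2 * B / e\<close> the first \<open>n0\<close> terms contribute
    less than \<open>e / 2\<close> to the average; each later term is itself below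
    \<open>e / 2\<close>.\<close>
  obtain n1 :: nat where n1: "real n1 > 2 * B / e" using reals_Archimedean2 by blast
  show "\<exists>no. \<forall>n\<ge>no. norm ((\<Sum>k=1..n. x k) / real n - 0) < e"
  proof (intro exI allI impI)
    fix n assume n: "n \<ge> n0 + n1 + 1"
    have "(\<Sum>k=1..n. \<bar>x k\<bar>) \<le> (\<Sum>k=1..n. (if k \<le> n0 then \<bar>x k\<bar> else 0) + e / 2)"
      using n0 e by (intro sum_mono) (auto simp: less_imp_le)
    also have "\<dots> = (\<Sum>k=1..n. if k \<le> n0 then \<bar>x k\<bar> else 0) + real n * (e / 2)"
      by (simp add: sum.distrib)
    also have "(\<Sum>k=1..n. if k \<le> n0 then \<bar>x k\<bar> else 0) = B"
      unfolding B_def using n by (intro sum.mono_neutral_cong_right) auto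
    finally have "\<bar>\<Sum>k=1..n. x k\<bar> \<le> B + real n * (e / 2)"
      using sum_abs[of x "{1..n}"] by linarith
    moreover have "B < real n * (e / 2)"
    proof -
      have "2 * B / e < real n" using n1 n by linarith
      thus ?thesis using e by (simp add: field_simps)
    qed
    moreover have "real n * (e / 2) = e * real n / 2" by simp
    ultimately have "\<bar>\<Sum>k=1..n. x k\<bar> < e * real n" by linarith
    thus "norm ((\<Sum>k=1..n. x k) / real n - 0) < e"
      using n by (simp add: field_simps)
  qed
qed

text \<open>Block \<open>n = p + 1\<close> starts after day \<open>(p + 1) * p * l / 2\<close>,
  which is at least \<open>p * p\<close> because \<open>l\<close> is at least 2. A start among the
  first \<open>N\<close> days thus has \<open>p\<close> at most \<open>sqrt N\<close>, leaving at
  most \<open>sqrt N + 1\<close> summands equal to \<open>C\<close>.\<close>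

lemma sum_indicator_block_starts_le:
  assumes "l > (1::nat)" "C \<ge> (0::real)"
  shows "(\<Sum>k=1..N. if k \<in> (\<lambda>n. n * (n - 1) * l div 2 + 1) ` {1..} then C else 0)
     \<le> C * (sqrt (real N) + 1)"
proof -
  let ?f = "\<lambda>n::nat. n * (n - 1) * l div 2 + 1"
  let ?m = "nat \<lfloor>sqrt (real N)\<rfloor> + 1"
  have sub: "{k \<in> {1..N}. k \<in> ?f ` {1..}} \<subseteq> ?f ` {1..?m}"
  proof
    fix k assume "k \<in> {k \<in> {1..N}. k \<in> ?f ` {1..}}"
    then obtain n where n: "n \<ge> 1" "k = ?f n" "?f n \<le> N" by auto
    obtain p where p: "n = Suc p" using n(1) by (cases n) auto
    have "p * p \<le> Suc p * p" by simp
    also have "\<dots> = Suc p * p * 2 div 2" by simp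
    also have "\<dots> \<le> Suc p * p * l div 2"
      by (rule div_le_mono) (rule mult_le_mono2, use assms in simp)
    also have "\<dots> \<le> N" using n(3) p by simp
    finally have "real p * real p \<le> real N" by (metis of_nat_le_iff of_nat_mult)
    hence "real p \<le> sqrt (real N)" by (simp add: real_le_rsqrt power2_eq_square)
    hence "p \<le> nat \<lfloor>sqrt (real N)\<rfloor>" by (simp add: le_nat_floor)
    thus "k \<in> ?f ` {1..?m}" using n p by (intro image_eqI[of _ _ n]) auto
  qed
  have "card {k \<in> {1..N}. k \<in> ?f ` {1..}} \<le> card (?f ` {1..?m})"
    by (rule card_mono[OF _ sub]) simp
  also have "\<dots> \<le> ?m" using card_image_le[of "{1..?m}" ?f] by simp
  finally have "real (card {k \<in> {1..N}. k \<in> ?f ` {1..}}) \<le> real ?m" by (rule of_nat_mono)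
  also have "\<dots> \<le> sqrt (real N) + 1" by (simp add: of_nat_floor)
  finally have "real (card {k \<in> {1..N}. k \<in> ?f ` {1..}}) \<le> sqrt (real N) + 1" .
  moreover have "(\<Sum>k=1..N. if k \<in> ?f ` {1..} then C else 0)
      = real (card {k \<in> {1..N}. k \<in> ?f ` {1..}}) * C"
    by (subst sum.inter_filter[symmetric]) auto
  ultimately show ?thesis using assms by (simp add: mult.commute mult_left_mono)
qed

section \<open>Arrangement of the blocks\<close>

lemma block_cover:
  assumes "l > (0::nat)" "k \<ge> 1"
  shows "\<exists>n\<ge>1. k \<in> block l n"
proof -
  let ?P = "\<lambda>n. k \<le> n * (n + 1) * l div 2"
  \<comment> \<open>\<open>n = k\<close> is a crude witness that some block end reaches
    \<open>k\<close>, so a least such index exists.\<close>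
  have "k = k * 1 * 2 div 2" by simp
  also have "\<dots> \<le> k * (k + 1) * l div 2"
  proof (rule div_le_mono)
    have "2 * 1 \<le> (k + 1) * l" using assms by (intro mult_le_mono) auto
    thus "k * 1 * 2 \<le> k * (k + 1) * l"
      using mult_le_mono2[of "2 * 1" "(k + 1) * l" k] by (simp only: mult.assoc mult_1_left mult_1_right)
  qed
  finally have ex: "?P k" .
  define n where "n = (LEAST n. ?P n)"
  have Pn: "?P n" unfolding n_def using ex by (rule LeastI)
  have n: "n \<ge> 1" using Pn assms by (cases n) auto
  \<comment> \<open>Block \<open>n - 1\<close> ends on the day before block \<open>n\<close> starts,
    so minimality of \<open>n\<close> puts \<open>k\<close> at or beyond that start.\<close>
  have "\<not> ?P (n - 1)"
    using not_less_Least[of "n - 1" ?P] n unfolding n_def[symmetric] by auto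
  hence "k \<ge> n * (n - 1) * l div 2 + 1" using n by (simp add: mult.commute)
  thus ?thesis using Pn n unfolding block_def by auto
qed

text \<open>A day beyond the end of block \<open>Z\<close> cannot lie in a block of smaller index.
  This transfers convergence along block indices to convergence along days.\<close>

lemma block_index_at_top:
  assumes "\<And>k. k \<ge> 1 \<Longrightarrow> k \<in> block l (b k)"
  shows "filterlim b at_top sequentially"
  unfolding filterlim_at_top eventually_sequentially
proof
  fix Z
  show "\<exists>N. \<forall>n\<ge>N. Z \<le> b n"
  proof (intro exI allI impI)
    fix k assume k: "k \<ge> Z * (Z + 1) * l div 2 + 1"
    show "Z \<le> b k"
    proof (rule ccontr)
      assume "\<not> Z \<le> b k"
      hence "b k * (b k + 1) * l div 2 \<le> Z * (Z + 1) * l div 2"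
        by (intro div_le_mono mult_le_mono) auto
      moreover have "k \<le> b k * (b k + 1) * l div 2"
        using assms[of k] k unfolding block_def by auto
      ultimately show False using k by linarith
    qed
  qed
qed

lemma block_start_or_step:
  assumes "k + 1 \<in> block l n" "k \<ge> 1"
  shows "k + 1 = n * (n - 1) * l div 2 + 1 \<or> k \<in> block l n"
  using assms unfolding block_def by auto

section \<open>Returns and portfolios\<close>

lemma rho_sum_scaleR:
  "rho (\<Sum>s\<in>S. a s *\<^sub>R Q s) u v = (\<Sum>s\<in>S. a s * rho (Q s) u v)"
  unfolding rho_def by (simp add: fst_sum snd_sum sum.distrib distrib_left)

lemma diamond_prod_unit_matrix: "unit_matrix i j \<diamondop> R = rho R i j"
proof -
  have "unit_matrix i j \<diamondop> R = (\<Sum>u\<in>UNIV. \<Sum>v\<in>UNIV. if u = i then (if v = j then rho R u v else 0) else 0)"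
    unfolding diamond_prod_def unit_matrix_def by (intro sum.cong refl) auto
  also have "\<dots> = (\<Sum>u\<in>UNIV. if u = i then (\<Sum>v\<in>UNIV. if v = j then rho R u v else 0) else 0)"
    by (intro sum.cong refl) auto
  also have "\<dots> = rho R i j" by simp
  finally show ?thesis .
qed

lemma portfolio_nonneg: "portfolio \<psi> \<Longrightarrow> \<psi> $ u $ v \<ge> 0"
  unfolding portfolio_def by (cases "u = v") (auto simp: less_imp_le)

lemma portfolio_le_1:
  fixes \<psi> :: "real ^ 'm ^ 'm::finite"
  assumes "portfolio \<psi>"
  shows "\<psi> $ u $ v \<le> 1"
proof -
  have "\<psi> $ u $ v \<le> (\<Sum>v\<in>UNIV. \<psi> $ u $ v)"
    by (rule member_le_sum) (auto simp: portfolio_nonneg[OF assms])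
  also have "\<dots> \<le> (\<Sum>u\<in>UNIV. \<Sum>v\<in>UNIV. \<psi> $ u $ v)"
    by (rule member_le_sum) (auto intro!: sum_nonneg simp: portfolio_nonneg[OF assms])
  also have "\<dots> = 1" using assms unfolding portfolio_def by simp
  finally show ?thesis .
qed

text \<open>The product averages the returns with weights \<open>\<psi>\<close>; the diagonal has
  weight 0, so a bound off the diagonal suffices.\<close>

lemma diamond_prod_ge:
  fixes \<psi> :: "real ^ 'm ^ 'm::finite"
  assumes "portfolio \<psi>" "\<And>u v. u \<noteq> v \<Longrightarrow> rho R u v \<ge> r"
  shows "\<psi> \<diamondop> R \<ge> r"
proof -
  have "r = r * (\<Sum>u\<in>UNIV. \<Sum>v\<in>UNIV. \<psi> $ u $ v)"
    using assms(1) unfolding portfolio_def by simp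
  also have "\<dots> = (\<Sum>u\<in>UNIV. \<Sum>v\<in>UNIV. \<psi> $ u $ v * r)"
    by (simp add: sum_distrib_left mult.commute)
  also have "\<dots> \<le> (\<Sum>u\<in>UNIV. \<Sum>v\<in>UNIV. \<psi> $ u $ v * rho R u v)"
  proof (intro sum_mono)
    fix u v
    show "\<psi> $ u $ v * r \<le> \<psi> $ u $ v * rho R u v"
      using assms portfolio_nonneg[OF assms(1), of u v]
      by (cases "u = v") (auto simp: portfolio_def intro: mult_left_mono)
  qed
  finally show ?thesis unfolding diamond_prod_def .
qed

lemma portfolio_end_of_day:
  fixes \<psi> :: "real ^ 'm ^ 'm::finite"
  assumes "portfolio \<psi>" "\<And>u v. u \<noteq> v \<Longrightarrow> rho R u v > 0" "\<psi> \<diamondop> R > 0"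
  shows "portfolio (end_of_day \<psi> R)"
proof -
  have "(\<Sum>u\<in>UNIV. \<Sum>v\<in>UNIV. \<psi> $ u $ v * rho R u v / (\<psi> \<diamondop> R)) = 
      (\<Sum>u\<in>UNIV. \<Sum>v\<in>UNIV. \<psi> $ u $ v * rho R u v) / (\<psi> \<diamondop> R)"
    by (simp add: sum_divide_distrib)
  also have "\<dots> = 1" using assms(3) by (simp flip: diamond_prod_def)
  finally have "(\<Sum>u\<in>UNIV. \<Sum>v\<in>UNIV. \<psi> $ u $ v * rho R u v / (\<psi> \<diamondop> R)) = 1" .
  thus ?thesis using assms unfolding portfolio_def end_of_day_def by simp
qed

section \<open>One step of the algorithms\<close>

text \<open>The normaliser \<open>Z\<close> is a weighted average of numbers between 1 and
  \<open>exp (g * M)\<close>, so it lies there too, and every factor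
  \<open>exp (g * x u v) / Z\<close> is between \<open>exp (- (g * M))\<close> and
  \<open>exp (g * M)\<close>. The abstract \<open>x\<close> serves both algorithms.\<close>

lemma exponential_reweighting:
  fixes p q :: "real ^ 'm ^ 'm::finite"
  assumes p: "portfolio p" and x: "\<And>u v. 0 \<le> x u v \<and> x u v \<le> M" and g: "g \<ge> 0"
    and q: "q = (\<chi> u v. p $ u $ v * exp (g * x u v) /
        (\<Sum>u\<in>UNIV. \<Sum>v\<in>UNIV. p $ u $ v * exp (g * x u v)))"
  shows "portfolio q" "p $ u $ v * exp (- (g * M)) \<le> q $ u $ v"
    "q $ u $ v \<le> p $ u $ v * exp (g * M)"
proof -
  define Z where "Z = (\<Sum>u\<in>UNIV. \<Sum>v\<in>UNIV. p $ u $ v * exp (g * x u v))"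
  have p1: "(\<Sum>u\<in>UNIV. \<Sum>v\<in>UNIV. p $ u $ v) = 1" using p unfolding portfolio_def by simp
  note p0 = portfolio_nonneg[OF p]
  have gx: "0 \<le> g * x u v" "g * x u v \<le> g * M" for u v
    using x g by (auto intro: mult_left_mono)
  have "(\<Sum>u\<in>UNIV. \<Sum>v\<in>UNIV. p $ u $ v * 1) \<le> Z" unfolding Z_def
    using gx p0 by (intro sum_mono mult_left_mono) auto
  hence Z1: "1 \<le> Z" using p1 by simp
  have "Z \<le> (\<Sum>u\<in>UNIV. \<Sum>v\<in>UNIV. p $ u $ v * exp (g * M))" unfolding Z_def
    using gx p0 by (intro sum_mono mult_left_mono) auto
  hence Z2: "Z \<le> exp (g * M)" using p1 by (simp flip: sum_distrib_right)
  have qe: "q $ u $ v = p $ u $ v * exp (g * x u v) / Z" for u v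
    using q unfolding Z_def by simp
  have "(\<Sum>u\<in>UNIV. \<Sum>v\<in>UNIV. q $ u $ v) = Z / Z"
    unfolding qe by (subst (2) Z_def) (simp add: sum_divide_distrib)
  thus "portfolio q" using p Z1 unfolding portfolio_def by (simp add: qe)
  have "p $ u $ v * (1 / exp (g * M)) \<le> p $ u $ v * (exp (g * x u v) / Z)"
    using Z1 Z2 gx p0 by (intro mult_left_mono frac_le) auto
  thus "p $ u $ v * exp (- (g * M)) \<le> q $ u $ v" by (simp add: qe exp_minus field_simps)
  have "p $ u $ v * (exp (g * x u v) / Z) \<le> p $ u $ v * (exp (g * M) / 1)"
    using Z1 Z2 gx p0 by (intro mult_left_mono frac_le) auto
  thus "q $ u $ v \<le> p $ u $ v * exp (g * M)" by (simp add: qe)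
qed

lemma abs_diff_le_of_exp_bounds:
  assumes "p * exp (- t) \<le> q" "q \<le> p * exp t" "(p::real) \<ge> 0"
  shows "\<bar>q - p\<bar> \<le> p * (exp t - 1)"
proof -
  \<comment> \<open>This says \<open>1 - exp (- t) \<le> exp t - 1\<close>, so the downward
    deviation obeys the upward bound.\<close>
  have "2 \<le> exp t + exp (- t)" using exp_ge_add_one_self[of t] exp_ge_add_one_self[of "-t"] by linarith
  hence "p * 2 \<le> p * (exp t + exp (- t))" using assms(3) by (rule mult_left_mono)
  thus ?thesis using assms by (simp add: algebra_simps abs_le_iff)
qed

lemma algorithm_step:
  fixes p q :: "real ^ 'm ^ 'm::finite"
  assumes alg: "alg = iitc \<or> alg = eiitc" and q: "q = alg g Q p"
    and p: "portfolio p" and g: "g \<ge> 0" and r: "0 < r" "r < 1"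
    and Q: "\<And>u v. 0 \<le> rho Q u v" "\<And>u v. rho Q u v \<le> 1" "\<And>u v. u \<noteq> v \<Longrightarrow> r \<le> rho Q u v"
  shows "portfolio q" "p $ u $ v * exp (- (g / r)) \<le> q $ u $ v"
    "\<bar>q $ u $ v - p $ u $ v\<bar> \<le> p $ u $ v * (exp (g / r) - 1)"
proof -
  \<comment> \<open>Both choices of \<open>x\<close> are at most \<open>1 / r\<close>: for IITC the
    predicted returns are at most 1, and EIITC divides them by \<open>p \<diamondop> Q\<close>,
    which is at least \<open>r\<close>.\<close>
  define x where "x = (\<lambda>u v. if alg = iitc then rho Q u v else rho Q u v / (p \<diamondop> Q))"
  have pq: "p \<diamondop> Q \<ge> r" by (rule diamond_prod_ge[OF p Q(3)])
  have "1 / 1 \<le> 1 / r" using r by (intro frac_le) auto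
  hence "rho Q u v \<le> 1 / r" for u v using Q(2)[of u v] by simp
  moreover have "rho Q u v / (p \<diamondop> Q) \<le> 1 / r" "0 \<le> rho Q u v / (p \<diamondop> Q)" for u v
    using Q r pq by (auto intro!: frac_le divide_nonneg_nonneg)
  ultimately have x: "0 \<le> x u v \<and> x u v \<le> 1 / r" for u v unfolding x_def using Q(1) by auto
  have "q = (\<chi> u v. p $ u $ v * exp (g * x u v) /
        (\<Sum>u\<in>UNIV. \<Sum>v\<in>UNIV. p $ u $ v * exp (g * x u v)))"
    using alg unfolding q x_def by (cases "alg = iitc") (simp_all add: iitc_def eiitc_def)
  note * = exponential_reweighting[OF p x g this]
  show "portfolio q" by (rule *)
  show "p $ u $ v * exp (- (g / r)) \<le> q $ u $ v" using *(2) by simp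
  show "\<bar>q $ u $ v - p $ u $ v\<bar> \<le> p $ u $ v * (exp (g / r) - 1)"
    using *(2,3) by (intro abs_diff_le_of_exp_bounds portfolio_nonneg[OF p]) auto
qed

section \<open>Transaction costs\<close>

text \<open>Since \<open>t\<close> occurs on both sides of its equation, each bound on the sum
  becomes a linear inequality to solve for \<open>t\<close>. The bound \<open>2 - t\<close> holds
  for any two portfolios and serves block starts; if \<open>q\<close> differs from \<open>p\<close>
  by a relative error \<open>\<delta>\<close>, the bound \<open>t + \<delta>\<close> gives a loss of
  order \<open>\<delta>\<close>.\<close>

lemma ln_one_minus_cost_ge:
  fixes p q :: "real ^ 'm ^ 'm::finite"
  assumes p: "portfolio p" and q: "portfolio q" and c: "0 < c" "c < 1" and t: "t < 1"
    and eq: "t = c * (\<Sum>u\<in>UNIV. \<Sum>v\<in>UNIV. \<bar>(1 - t) * q $ u $ v - p $ u $ v\<bar>)"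
  shows "ln (1 - t) \<ge> ln ((1 - c) / (1 + c))"
    and "(\<And>u v. \<bar>q $ u $ v - p $ u $ v\<bar> \<le> p $ u $ v * \<delta>) \<Longrightarrow>
      ln (1 - t) \<ge> - (c * (1 + c) / (1 - c)\<^sup>2 * \<delta>)"
proof -
  have p1: "(\<Sum>u\<in>UNIV. \<Sum>v\<in>UNIV. p $ u $ v) = 1"
    and q1: "(\<Sum>u\<in>UNIV. \<Sum>v\<in>UNIV. q $ u $ v) = 1"
    using p q unfolding portfolio_def by simp_all
  note p0 = portfolio_nonneg[OF p] and q0 = portfolio_nonneg[OF q]
  have t0: "t \<ge> 0" using c by (subst eq) (intro mult_nonneg_nonneg sum_nonneg, auto)
  have "(\<Sum>u\<in>UNIV. \<Sum>v\<in>UNIV. \<bar>(1 - t) * q $ u $ v - p $ u $ v\<bar>)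
      \<le> (\<Sum>u\<in>UNIV. \<Sum>v\<in>UNIV. (1 - t) * q $ u $ v + p $ u $ v)"
    using t p0 q0 by (intro sum_mono) (simp add: abs_le_iff)
  also have "\<dots> = 2 - t" using p1 q1 by (simp add: sum.distrib flip: sum_distrib_left)
  finally have "t \<le> c * (2 - t)"
    by (rule ord_eq_le_trans[OF eq mult_left_mono[OF _ less_imp_le[OF c(1)]]])
  hence le: "(1 - c) / (1 + c) \<le> 1 - t" using c by (simp add: field_simps)
  show "ln (1 - t) \<ge> ln ((1 - c) / (1 + c))" using le c by (intro ln_mono) auto
  assume d: "\<And>u v. \<bar>q $ u $ v - p $ u $ v\<bar> \<le> p $ u $ v * \<delta>"
  have "(\<Sum>u\<in>UNIV. \<Sum>v\<in>UNIV. \<bar>(1 - t) * q $ u $ v - p $ u $ v\<bar>)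
      \<le> (\<Sum>u\<in>UNIV. \<Sum>v\<in>UNIV. t * q $ u $ v + p $ u $ v * \<delta>)"
  proof (intro sum_mono)
    fix u v
    \<comment> \<open>Splitting off \<open>t * q\<close> separates the shrinkage by the cost, of
      total \<open>t\<close>, from the change of proportions, of total at most
      \<open>\<delta>\<close>.\<close>
    have "(1 - t) * q $ u $ v - p $ u $ v = (q $ u $ v - p $ u $ v) - t * q $ u $ v"
      by (simp add: algebra_simps)
    moreover have "t * q $ u $ v \<ge> 0" using t0 q0 by simp
    ultimately show "\<bar>(1 - t) * q $ u $ v - p $ u $ v\<bar> \<le> t * q $ u $ v + p $ u $ v * \<delta>"
      using d[of u v] by linarith
  qed
  also have "\<dots> = t + \<delta>"
    using p1 q1 by (simp add: sum.distrib flip: sum_distrib_left sum_distrib_right)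
  finally have "t \<le> c * (t + \<delta>)"
    by (rule ord_eq_le_trans[OF eq mult_left_mono[OF _ less_imp_le[OF c(1)]]])
  hence td: "t \<le> c * \<delta> / (1 - c)" using c by (simp add: field_simps)
  \<comment> \<open>In \<open>t / (1 - t)\<close> the numerator takes the \<open>\<delta>\<close>
    bound and the denominator the crude bound; together they give the constant
    \<open>c * (1 + c) / (1 - c)\<^sup>2\<close>.\<close>
  have "ln (1 / (1 - t)) \<le> 1 / (1 - t) - 1" using t by (intro ln_le_minus_one) simp
  hence "- ln (1 - t) \<le> t / (1 - t)" using t by (simp add: ln_div field_simps)
  also have "\<dots> \<le> (c * \<delta> / (1 - c)) / ((1 - c) / (1 + c))"
    using td le t0 c by (intro frac_le) auto
  also have "\<dots> = c * (1 + c) / (1 - c)\<^sup>2 * \<delta>" by (simp add: power2_eq_square)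
  finally show "ln (1 - t) \<ge> - (c * (1 + c) / (1 - c)\<^sup>2 * \<delta>)" by linarith
qed

text \<open>Every term of the cost equation carries the factor \<open>F k\<close>: the new capital
  is \<open>F k * (1 - t)\<close>, and the old holdings are \<open>F k\<close> times the end-of-day
  proportions. Dividing by \<open>F k\<close> leaves an equation between proportions only.\<close>

lemma cost_ratio_eq:
  fixes \<psi> :: "nat \<Rightarrow> real ^ 'm ^ 'm::finite"
  assumes cap: "capital_process c F F' T \<psi> R" and k: "k \<ge> 1"
    and D: "\<psi> k \<diamondop> R k > 0" "\<psi> (k + 1) \<diamondop> R (k + 1) > 0"
  defines "t \<equiv> cost_ratio F T (k + 1)"
  shows "t < 1" "t = c * (\<Sum>u\<in>UNIV. \<Sum>v\<in>UNIV.
    \<bar>(1 - t) * \<psi> (k + 1) $ u $ v - end_of_day (\<psi> k) (R k) $ u $ v\<bar>)"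
proof -
  have Fpos: "F n > 0" for n using cap unfolding capital_process_def by blast
  have F: "\<And>n. n \<ge> 1 \<Longrightarrow> F n = F' n * (\<psi> n \<diamondop> R n)"
    and F': "\<And>n. n \<ge> 1 \<Longrightarrow> F' n = F (n - 1) - T n"
    and T: "T (k + 1) = c * (\<Sum>u\<in>UNIV. \<Sum>v\<in>UNIV.
        \<bar>F' (k + 1) * \<psi> (k + 1) $ u $ v - F' k * \<psi> k $ u $ v * rho (R k) u v\<bar>)"
    using cap k unfolding capital_process_def by blast+
  note Fk = F[OF k]
  have Fk1: "F (k + 1) = F' (k + 1) * (\<psi> (k + 1) \<diamondop> R (k + 1))" by (rule F) simp
  have F'k1: "F' (k + 1) = F k - T (k + 1)" using F'[of "k + 1"] by simp
  \<comment> \<open>As \<open>k + 1\<close> is at least 2, \<open>cost_ratio\<close> is in its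
    quotient branch.\<close>
  have t: "t = T (k + 1) / F k" using k unfolding t_def cost_ratio_def by simp
  \<comment> \<open>Capital and return factor of day \<open>k + 1\<close> are both positive, so
    something is left after the cost; this forces \<open>t < 1\<close>.\<close>
  have F'pos: "F' (k + 1) > 0" using Fpos[of "k + 1"] D(2) unfolding Fk1 by (simp add: zero_less_mult_iff)
  show "t < 1" using t F'pos F'k1 Fpos[of k] by simp
  have F't: "F' (k + 1) = F k * (1 - t)" using F'k1 t Fpos[of k] by (simp add: field_simps)
  have e: "F' k * \<psi> k $ u $ v * rho (R k) u v = F k * end_of_day (\<psi> k) (R k) $ u $ v" for u v
    using D(1) Fk unfolding end_of_day_def by simp
  have "F' (k + 1) * \<psi> (k + 1) $ u $ v - F' k * \<psi> k $ u $ v * rho (R k) u v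
      = F k * ((1 - t) * \<psi> (k + 1) $ u $ v - end_of_day (\<psi> k) (R k) $ u $ v)" for u v
    unfolding e F't by (simp add: algebra_simps)
  hence "\<bar>F' (k + 1) * \<psi> (k + 1) $ u $ v - F' k * \<psi> k $ u $ v * rho (R k) u v\<bar>
      = F k * \<bar>(1 - t) * \<psi> (k + 1) $ u $ v - end_of_day (\<psi> k) (R k) $ u $ v\<bar>" for u v
    using Fpos[of k] by (simp only: abs_mult abs_of_pos)
  hence "T (k + 1) = F k * (c * (\<Sum>u\<in>UNIV. \<Sum>v\<in>UNIV.
        \<bar>(1 - t) * \<psi> (k + 1) $ u $ v - end_of_day (\<psi> k) (R k) $ u $ v\<bar>))"
    unfolding T by (simp only: sum_distrib_left mult.left_commute)
  hence "T (k + 1) / F k = c * (\<Sum>u\<in>UNIV. \<Sum>v\<in>UNIV.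
        \<bar>(1 - t) * \<psi> (k + 1) $ u $ v - end_of_day (\<psi> k) (R k) $ u $ v\<bar>)"
    using Fpos[of k] by simp
  thus "t = c * (\<Sum>u\<in>UNIV. \<Sum>v\<in>UNIV.
    \<bar>(1 - t) * \<psi> (k + 1) $ u $ v - end_of_day (\<psi> k) (R k) $ u $ v\<bar>)"
    by (rule trans[OF t])
qed

section \<open>Comparison of the growth rate with that of a single pair\<close>

theorem corollary5p2:
  fixes R R' :: "nat \<Rightarrow> 'm::finite retmat"
    and \<psi> :: "nat \<Rightarrow> real ^ 'm ^ 'm"
    and F F' T :: "nat \<Rightarrow> real"
    and d :: "nat \<Rightarrow> nat"
    and a :: "nat \<Rightarrow> nat \<Rightarrow> real"
    and \<gamma> :: "nat \<Rightarrow> real"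
    and l :: nat
    and r c \<epsilon> :: real
    and alg :: "real \<Rightarrow> 'm retmat \<Rightarrow> real ^ 'm ^ 'm \<Rightarrow> real ^ 'm ^ 'm"
    and i j :: 'm
  assumes currencies: "CARD('m) > 1"
    and returns: "\<And>k. k \<ge> 1 \<Longrightarrow> return_matrix (R k)"
    and r: "0 < r" "r < 1"
    and returns_lower: "\<And>k u v. k \<ge> 1 \<Longrightarrow> u \<noteq> v \<Longrightarrow> rho (R k) u v \<ge> r"
    and returns_max: "\<And>k. k \<ge> 1 \<Longrightarrow> (MAX (u, v)\<in>UNIV. rho (R k) u v) = 1"
    and window: "\<And>k. k \<ge> 1 \<Longrightarrow> 1 \<le> d k \<and> d k \<le> k"
    and weights_nonneg: "\<And>k s. k \<ge> 1 \<Longrightarrow> s \<in> {1..d k} \<Longrightarrow> a k s \<ge> 0"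
    and weights_sum: "\<And>k. k \<ge> 1 \<Longrightarrow> (\<Sum>s=1..d k. a k s) = 1"
    and prediction: "\<And>k. k \<ge> 1 \<Longrightarrow> R' (k + 1) = (\<Sum>s=1..d k. a k s *\<^sub>R R (k - s + 1))"
    and cost_const: "0 < c" "c < 1"
    and capital: "capital_process c F F' T \<psi> R"
    and block_length: "l > 1"
    and gamma_pos: "\<And>n. n \<ge> 1 \<Longrightarrow> \<gamma> n > 0"
    and gamma_lim: "\<gamma> \<longlonglongrightarrow> 0"
    and eps: "\<epsilon> > 0"
    and block_start: "\<And>n. n \<ge> 1 \<Longrightarrow> portfolio (\<psi> (n * (n - 1) * l div 2 + 1))"
    and block_start_lower:
      "\<And>n u v. n \<ge> 1 \<Longrightarrow> u \<noteq> v \<Longrightarrow> \<psi> (n * (n - 1) * l div 2 + 1) $ u $ v \<ge> \<epsilon>"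
    and algorithm: "alg = iitc \<or> alg = eiitc"
    and update: "\<And>n k. n \<ge> 1 \<Longrightarrow> k \<in> block l n \<Longrightarrow> k + 1 \<in> block l n \<Longrightarrow>
      \<psi> (k + 1) = alg (\<gamma> n) (R' (k + 1)) (end_of_day (\<psi> k) (R k))"
    and pair: "i \<noteq> j"
  shows "liminf (\<lambda>N. ereal (growth_rate_tc N \<psi> R (cost_ratio F T)
                            - growth_rate_single N (unit_matrix i j) R)) \<ge> 0"
proof -
  define p where "p = (\<lambda>k. end_of_day (\<psi> k) (R k))"
  define D where "D = (\<lambda>k. \<psi> k \<diamondop> R k)"
  define t where "t = cost_ratio F T"
  define S where "S = (\<lambda>n. n * (n - 1) * l div 2 + 1) ` {1::nat..}"
  \<comment> \<open>\<open>K\<close> is the constant of the cost bound for small changes.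
    \<open>C\<close> collects the losses of a block start: \<open>- ln \<epsilon>\<close> for the
    entry of the new portfolio and the crude bound on the logarithmic cost.\<close>
  define K where "K = c * (1 + c) / (1 - c)\<^sup>2"
  define C where "C = - ln \<epsilon> - ln ((1 - c) / (1 + c))"
  obtain b where b: "\<And>k. k \<ge> 1 \<Longrightarrow> b k \<ge> 1 \<and> k \<in> block l (b k)"
    using block_cover[of l] block_length by (metis less_trans zero_less_one)
  \<comment> \<open>\<open>\<eta> k\<close> bounds the loss of day \<open>k\<close>. Inside a block
    the summand 1 pays for the shift of the entry \<open>(i, j)\<close> and \<open>K\<close> for the
    transaction cost.\<close>
  define \<eta> where "\<eta> = (\<lambda>k. (1 + K) * (exp (\<gamma> (b k) / r) - 1) + (if k \<in> S then C else 0))"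
  have K: "K \<ge> 0" unfolding K_def using cost_const by simp
  \<comment> \<open>Each day after the first is a block start, controlled by
    \<open>\<epsilon>\<close>, or arises by one step of the algorithm.\<close>
  have S_cases: "k + 1 \<in> S \<or> k \<in> block l (b (k + 1))" if "k \<ge> 1" for k
    using block_start_or_step[of k l "b (k + 1)"] b[of "k + 1"] that unfolding S_def by auto
  have S: "portfolio (\<psi> k)" "\<psi> k $ i $ j \<ge> \<epsilon>" if "k \<in> S" for k
    using that block_start block_start_lower[OF _ pair] unfolding S_def by auto
  have "1 \<in> S" unfolding S_def by force

  \<comment> \<open>Bounds on returns and predictions\<close>
  have rho0: "rho (R k) u v \<ge> 0" if "k \<ge> 1" for k u v
    using returns[OF that] unfolding return_matrix_def rho_def by simp
  have rho1: "rho (R k) u v \<le> 1" if "k \<ge> 1" for k u v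
  proof -
    have "rho (R k) u v \<le> (MAX (u, v)\<in>UNIV. rho (R k) u v)"
      by (rule Max_ge) (auto intro!: image_eqI[of _ _ "(u, v)"])
    thus ?thesis using returns_max[OF that] by simp
  qed
  have rhopos: "rho (R k) u v > 0" if "k \<ge> 1" "u \<noteq> v" for k u v
    using returns_lower[OF that] r by linarith

  \<comment> \<open>A prediction is a convex combination of returns of days
    \<open>k - s + 1\<close>, all at least 1, so it inherits their entrywise bounds.\<close>
  have convex: "x \<le> rho (R' (k + 1)) u v \<and> rho (R' (k + 1)) u v \<le> y"
    if k: "k \<ge> 1" and xy: "\<And>n. n \<ge> 1 \<Longrightarrow> x \<le> rho (R n) u v \<and> rho (R n) u v \<le> y" for k u v x y
  proof -
    have e: "rho (R' (k + 1)) u v = (\<Sum>s=1..d k. a k s * rho (R (k - s + 1)) u v)"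
      unfolding prediction[OF k] by (rule rho_sum_scaleR)
    have "(\<Sum>s=1..d k. a k s * x) \<le> (\<Sum>s=1..d k. a k s * rho (R (k - s + 1)) u v)"
      "(\<Sum>s=1..d k. a k s * rho (R (k - s + 1)) u v) \<le> (\<Sum>s=1..d k. a k s * y)"
      using xy weights_nonneg[OF k] by (intro sum_mono mult_left_mono; simp)+
    thus ?thesis unfolding e using weights_sum[OF k] by (simp flip: sum_distrib_right)
  qed
  have pred0: "0 \<le> rho (R' (k + 1)) u v" and pred1: "rho (R' (k + 1)) u v \<le> 1"
    if "k \<ge> 1" for k u v
    using convex[OF that, of 0 u v 1] rho0 rho1 by auto
  have predr: "r \<le> rho (R' (k + 1)) u v" if "k \<ge> 1" "u \<noteq> v" for k u v
    using convex[OF that(1), of r u v 1] returns_lower[OF _ that(2)] rho1 by auto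

  \<comment> \<open>Portfolios generated along the days\<close>
  have Dpos: "D k > 0" if "k \<ge> 1" "portfolio (\<psi> k)" for k
    using diamond_prod_ge[OF that(2) returns_lower[OF that(1)]] r unfolding D_def by simp
  have pp: "portfolio (p k)" if "k \<ge> 1" "portfolio (\<psi> k)" for k
    unfolding p_def using that Dpos[OF that] rhopos[OF that(1)]
    by (intro portfolio_end_of_day) (auto simp: D_def)
  have step_facts: "portfolio (\<psi> (k + 1))"
      "p k $ u $ v * exp (- (\<gamma> (b (k + 1)) / r)) \<le> \<psi> (k + 1) $ u $ v"
      "\<bar>\<psi> (k + 1) $ u $ v - p k $ u $ v\<bar> \<le> p k $ u $ v * (exp (\<gamma> (b (k + 1)) / r) - 1)"
    if k: "k \<ge> 1" "portfolio (\<psi> k)" "k \<in> block l (b (k + 1))" for k u v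
  proof -
    have bk: "b (k + 1) \<ge> 1" "k + 1 \<in> block l (b (k + 1))" using b[of "k + 1"] by auto
    have g: "\<gamma> (b (k + 1)) \<ge> 0" using gamma_pos[OF bk(1)] by simp
    have "\<psi> (k + 1) = alg (\<gamma> (b (k + 1))) (R' (k + 1)) (p k)"
      unfolding p_def by (rule update[OF bk(1) k(3) bk(2)])
    note * = algorithm_step[OF algorithm this pp[OF k(1,2)] g r pred0[OF k(1)] pred1[OF k(1)]
        predr[OF k(1)]]
    show "portfolio (\<psi> (k + 1))" by (rule *) assumption
    show "p k $ u $ v * exp (- (\<gamma> (b (k + 1)) / r)) \<le> \<psi> (k + 1) $ u $ v"
      by (rule *) assumption
    show "\<bar>\<psi> (k + 1) $ u $ v - p k $ u $ v\<bar> \<le> p k $ u $ v * (exp (\<gamma> (b (k + 1)) / r) - 1)"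
      by (rule *) assumption
  qed
  have port: "portfolio (\<psi> k)" if "k \<ge> 1" for k
    using that
  proof (induction k rule: nat_induct_at_least)
    case base
    show ?case using S(1) \<open>1 \<in> S\<close> .
  next
    case (Suc k)
    thus ?case using S_cases[of k] S(1) step_facts(1)[of k] by auto
  qed

  \<comment> \<open>Daily losses and their telescoping sum\<close>
  have \<delta>0: "exp (\<gamma> (b k) / r) - 1 \<ge> \<gamma> (b k) / r" "\<gamma> (b k) / r \<ge> 0" if "k \<ge> 1" for k
  proof -
    show "exp (\<gamma> (b k) / r) - 1 \<ge> \<gamma> (b k) / r"
      using exp_ge_add_one_self[of "\<gamma> (b k) / r"] by linarith
    show "\<gamma> (b k) / r \<ge> 0" using gamma_pos[of "b k"] b[OF that] r by simp
  qed
  have C: "C \<ge> 0"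
  proof -
    have "\<epsilon> \<le> 1" using S(2)[OF \<open>1 \<in> S\<close>] portfolio_le_1[OF port[of 1], of i j] by simp
    hence "ln \<epsilon> \<le> 0" using eps by simp
    moreover have "ln ((1 - c) / (1 + c)) \<le> 0" using cost_const by (intro ln_le_zero_iff[THEN iffD2]) auto
    ultimately show ?thesis unfolding C_def by simp
  qed
  have ppos: "p k $ i $ j > 0" and p1: "p k $ i $ j \<le> 1" if "k \<ge> 1" for k
    using pp[OF that port[OF that]] pair portfolio_le_1[of "p k"] by (auto simp: portfolio_def)
  have rebalance: "ln (\<psi> (k + 1) $ i $ j) - ln (p k $ i $ j) + ln (1 - t (k + 1)) \<ge> - \<eta> (k + 1)"
    if k: "k \<ge> 1" for k
  proof -
    have pk1: "portfolio (\<psi> (k + 1))" using port[of "k + 1"] by simp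
    have "D (k + 1) > 0" by (rule Dpos[OF _ pk1]) simp
    note * = cost_ratio_eq[OF capital k Dpos[OF k port[OF k], unfolded D_def] this[unfolded D_def]]
    have cr: "t (k + 1) < 1" "t (k + 1) = c * (\<Sum>u\<in>UNIV. \<Sum>v\<in>UNIV.
        \<bar>(1 - t (k + 1)) * \<psi> (k + 1) $ u $ v - p k $ u $ v\<bar>)"
      unfolding t_def p_def by (fact *(1), fact *(2))
    note cost = ln_one_minus_cost_ge[OF pp[OF k port[OF k]] pk1 cost_const cr]
    show ?thesis
    proof (cases "k + 1 \<in> S")
      case True
      \<comment> \<open>The new portfolio need not be close to \<open>p k\<close> here, so only
        \<open>\<epsilon>\<close>, \<open>p k $ i $ j \<le> 1\<close> and the crude cost bound are
        available.\<close>
      have "ln (\<psi> (k + 1) $ i $ j) \<ge> ln \<epsilon>" using S(2)[OF True] eps by (intro ln_mono) auto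
      moreover have "ln (p k $ i $ j) \<le> 0" using ppos[OF k] p1[OF k] by simp
      moreover have "(1 + K) * (exp (\<gamma> (b (k + 1)) / r) - 1) \<ge> 0"
        using \<delta>0[of "k + 1"] K by (intro mult_nonneg_nonneg) auto
      ultimately show ?thesis using cost(1) True unfolding \<eta>_def C_def by simp
    next
      case False
      hence kb: "k \<in> block l (b (k + 1))" using S_cases[OF k] by simp
      note sf = step_facts[OF k port[OF k] kb]
      have "ln (1 - t (k + 1)) \<ge> - (K * (exp (\<gamma> (b (k + 1)) / r) - 1))"
        using cost(2)[OF sf(3)] unfolding K_def by simp
      moreover have "ln (p k $ i $ j * exp (- (\<gamma> (b (k + 1)) / r))) \<le> ln (\<psi> (k + 1) $ i $ j)"
        using sf(2) ppos[OF k] by (intro ln_mono) auto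
      hence "ln (p k $ i $ j) - \<gamma> (b (k + 1)) / r \<le> ln (\<psi> (k + 1) $ i $ j)"
        using ppos[OF k] by (simp add: ln_mult)
      \<comment> \<open>Enlarging the shift to \<open>exp (\<gamma> (b (k + 1)) / r) - 1\<close>
        merges it with the cost into the factor \<open>1 + K\<close>.\<close>
      moreover have "\<gamma> (b (k + 1)) / r \<le> exp (\<gamma> (b (k + 1)) / r) - 1" using \<delta>0[of "k + 1"] by simp
      ultimately show ?thesis using False unfolding \<eta>_def by (simp add: distrib_right)
    qed
  qed
  have excess: "ln (D k) - ln (rho (R k) i j) = ln (\<psi> k $ i $ j) - ln (p k $ i $ j)"
    if k: "k \<ge> 1" for k
  proof -
    have "\<psi> k $ i $ j > 0" using port[OF k] pair unfolding portfolio_def by auto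
    thus ?thesis using Dpos[OF k port[OF k]] rhopos[OF k pair]
      unfolding p_def end_of_day_def D_def by (simp add: ln_mult ln_div)
  qed
  \<comment> \<open>With \<open>ln (p N $ i $ j)\<close> added, passing to the next day adds exactly
    the quantity bounded in \<open>rebalance\<close>. This logarithm is at most 0 and is dropped
    afterwards.\<close>
  have potential: "(\<Sum>k=1..N. ln (D k) - ln (rho (R k) i j) + ln (1 - t k)) + ln (p N $ i $ j)
      \<ge> - (\<Sum>k=1..N. \<eta> k)" if "N \<ge> 1" for N
    using that
  proof (induction N rule: nat_induct_at_least)
    case base
    \<comment> \<open>Day 1 has no cost, so the left side collapses to
      \<open>ln (\<psi> 1 $ i $ j)\<close>.\<close>
    have "ln (\<psi> 1 $ i $ j) \<ge> ln \<epsilon>" using S(2)[OF \<open>1 \<in> S\<close>] eps by (intro ln_mono) auto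
    moreover have "(1 + K) * (exp (\<gamma> (b 1) / r) - 1) \<ge> 0"
      using \<delta>0[of 1] K by (intro mult_nonneg_nonneg) auto
    moreover have "ln ((1 - c) / (1 + c)) \<le> 0"
      using cost_const by (intro ln_le_zero_iff[THEN iffD2]) auto
    moreover have "\<eta> 1 = (1 + K) * (exp (\<gamma> (b 1) / r) - 1) + C" using \<open>1 \<in> S\<close> unfolding \<eta>_def by simp
    moreover have "t 1 = 0" unfolding t_def cost_ratio_def by simp
    ultimately show ?case using excess[of 1] unfolding C_def by simp
  next
    case (Suc N)
    thus ?case using rebalance[of N] excess[of "Suc N"] by simp
  qed
  have bound: "growth_rate_tc N \<psi> R t - growth_rate_single N (unit_matrix i j) R
      \<ge> - ((\<Sum>k=1..N. \<eta> k) / real N)" if N: "N \<ge> 1" for N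
  proof -
    have "growth_rate_tc N \<psi> R t - growth_rate_single N (unit_matrix i j) R
        = (\<Sum>k=1..N. ln (D k) - ln (rho (R k) i j) + ln (1 - t k)) / real N"
      unfolding growth_rate_tc_def growth_rate_single_def diamond_prod_unit_matrix D_def
      by (simp add: sum.distrib sum_subtractf add_divide_distrib diff_divide_distrib)
    moreover have "ln (p N $ i $ j) \<le> 0" using ppos[OF N] p1[OF N] by simp
    hence "- (\<Sum>k=1..N. \<eta> k) \<le> (\<Sum>k=1..N. ln (D k) - ln (rho (R k) i j) + ln (1 - t k))"
      using potential[OF N] by linarith
    hence "- (\<Sum>k=1..N. \<eta> k) / real N
        \<le> (\<Sum>k=1..N. ln (D k) - ln (rho (R k) i j) + ln (1 - t k)) / real N"
      by (rule divide_right_mono) simp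
    ultimately show ?thesis by simp
  qed

  \<comment> \<open>Passage to the limit\<close>
  have "(\<lambda>k. \<gamma> (b k)) \<longlonglongrightarrow> 0"
    using gamma_lim block_index_at_top[of l b] b by (auto intro: filterlim_compose)
  hence "(\<lambda>k. (1 + K) * (exp (\<gamma> (b k) / r) - 1)) \<longlonglongrightarrow> (1 + K) * (exp (0 / r) - 1)"
    using r by (intro tendsto_intros) auto
  hence lim1: "(\<lambda>N. (\<Sum>k=1..N. (1 + K) * (exp (\<gamma> (b k) / r) - 1)) / real N) \<longlonglongrightarrow> 0"
    by (intro cesaro_null) simp
  have "(\<lambda>N. C * (1 / sqrt (real N) + 1 / real N)) \<longlonglongrightarrow> C * (0 + 0)"
    by (intro tendsto_intros lim_1_over_n tendsto_divide_0[OF tendsto_const]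
        filterlim_at_top_imp_at_infinity filterlim_compose[OF sqrt_at_top filterlim_real_sequentially])
  \<comment> \<open>At \<open>N = 0\<close> both sides are 0, since division by 0 yields 0.\<close>
  moreover have "C * (1 / sqrt (real N) + 1 / real N) = C * (sqrt (real N) + 1) / real N" for N
    using sqrt_divide_self_eq[of "real N"]
    by (simp add: add_divide_distrib inverse_eq_divide flip: times_divide_eq_right)
  ultimately have lim2: "(\<lambda>N. C * (sqrt (real N) + 1) / real N) \<longlonglongrightarrow> 0" by simp
  have lim: "(\<lambda>N. ereal (- ((\<Sum>k=1..N. (1 + K) * (exp (\<gamma> (b k) / r) - 1)) / real N
      + C * (sqrt (real N) + 1) / real N))) \<longlonglongrightarrow> ereal (- (0 + 0))"
    by (intro tendsto_intros lim1 lim2)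
  have "(\<Sum>k=1..N. \<eta> k) / real N \<le> (\<Sum>k=1..N. (1 + K) * (exp (\<gamma> (b k) / r) - 1)) / real N
      + C * (sqrt (real N) + 1) / real N" for N
  proof -
    have "(\<Sum>k=1..N. \<eta> k) \<le> (\<Sum>k=1..N. (1 + K) * (exp (\<gamma> (b k) / r) - 1)) + C * (sqrt (real N) + 1)"
      using sum_indicator_block_starts_le[OF block_length C, of N]
      unfolding \<eta>_def S_def by (simp add: sum.distrib)
    thus ?thesis by (metis add_divide_distrib divide_right_mono of_nat_0_le_iff)
  qed
  with bound have ev: "\<forall>\<^sub>F N in sequentially.
      ereal (- ((\<Sum>k=1..N. (1 + K) * (exp (\<gamma> (b k) / r) - 1)) / real N
        + C * (sqrt (real N) + 1) / real N))
      \<le> ereal (growth_rate_tc N \<psi> R t - growth_rate_single N (unit_matrix i j) R)"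
    unfolding eventually_sequentially
    by (intro exI[of _ 1] allI impI) (simp, smt (verit))
  show ?thesis
    using Liminf_mono[OF ev] lim_imp_Liminf[OF sequentially_bot lim]
    unfolding t_def by (simp add: zero_ereal_def)
qed

end
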